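(* Let $T$ be an upper probability polynomial functor. For each $S\in\mathsf{Ing}\,T$, every axiom in $Ax_S$ is valid in every $T$-coalgebra $(X,\alpha)$, i.e. $[\![\varphi]\!]^\alpha_S=SX$ for all $\varphi\in Ax_S$.
   Context: An uncertainty space is $(X,\Sigma)$ with $\Sigma$ an algebra of subsets of $X$ (nonempty, closed under finite unions and complements $U^c=X\setminus U$); measurable maps pull measurable sets back. A probability measure is a finitely additive $\mu:\Sigma\to[0,1]$ with $\mu(\emptyset)=0,\mu(X)=1$. An upper probability measure is $g:\Sigma\to[0,1]$ with $g(U)=\sup_{\mu\in\mathcal P}\mu(U)$ for a nonempty set $\mathcal P$ of probability measures; $\underline g(U)=1-g(U^c)$. $\Delta^*X$: set of upper probability measures with the algebra generated by $\beta^{p,q}(U)=\{g:g(U)\ge p,\ 1-g(U^c)\ge q\}$ ($p,q\in[0,1]$); $(\Delta^*f)(g)(U)=g(f^{-1}(U))$. Products carry the algebra generated by measurable rectangles (projections $\pi_j$), coproducts (injections $in_j$) the algebra generated by the $in_j(U_j)$; constant functors send everything to a fixed $(M,\Sigma_M)$. Upper probability polynomial functors: smallest class of endofunctors of uncertainty spaces containing $Id$ and constants, closed under pointwise $\times$, $+$ and composition with $\Delta^*$. A $T$-coalgebra is $(X,\alpha)$ with $\alpha:X\to TX$ measurable. $\mathsf{Ing}\,T$: $\mathsf{Ing}\,Id=\{Id\}$, $\mathsf{Ing}\,M=\{M,Id\}$, $\mathsf{Ing}(T_1\times T_2)=\{T_1\times T_2\}\cup\mathsf{Ing}\,T_1\cup\mathsf{Ing}\,T_2$,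 same for $+$, $\mathsf{Ing}\,\Delta^*S=\{\Delta^*S\}\cup\mathsf{Ing}\,S$. Formulas of sort $S$: $\bot_S$; $\varphi\to\psi$; $A:M$ for $A\in\Sigma_M$ or $A=\{m\}$; $[\mathsf{pr}_j]\varphi:S_1\times S_2$ ($\varphi:S_j$); $[\mathsf{in}_j]\varphi:S_1+S_2$ ($\varphi:S_j$); $[\mathsf{next}]\varphi:Id$ ($\varphi:T$); $[(p,q)]\varphi:\Delta^*S$ for $p,q\in[0,1]$ and $\varphi::S$ (all constant subformulas measurable). Abbreviations: $\neg,\vee,\wedge,\leftrightarrow,\top_S$; $\mathsf U_{\ge p}\varphi=[(p,0)]\varphi$, $\mathsf L_{\ge p}\varphi=[(0,p)]\varphi$, $\mathsf U_{\le p}\varphi=[(0,1-p)]\neg\varphi$, $\mathsf U_{<p}=\neg\mathsf U_{\ge p}$. Semantics in $(X,\alpha)$: $[\![\bot]\!]=\emptyset$, $[\![A]\!]=A$, $[\![\varphi\to\psi]\!]=(SX\setminus[\![\varphi]\!])\cup[\![\psi]\!]$, $[\![[\mathsf{pr}_j]\varphi]\!]=\pi_j^{-1}[\![\varphi]\!]$, $[\![[\mathsf{in}_1]\varphi]\!]=in_1[\![\varphi]\!]\cup in_2(S_2X)$, $[\![[\mathsf{in}_2]\varphi]\!]=in_1(S_1X)\cup in_2[\![\varphi]\!]$, $[\![[\mathsf{next}]\varphi]\!]=\alpha^{-1}[\![\varphi]\!]_T$, $[\![[(p,q)]\varphi]\!]=\beta^{p,q}[\![\varphi]\!]$. Axioms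 $Ax_S$: all Boolean tautologies of sort $S$; for $S=M$ constant, $c\in M$, $A:M$: $\{c\}\to A$ if $c\in A$, $\{c\}\to\neg A$ if $c\notin A$; for $S=S_1\times S_2$, $\varphi:S_j$: $\neg[\mathsf{pr}_j]\varphi\to[\mathsf{pr}_j]\neg\varphi$ and $\neg[\mathsf{pr}_j]\bot_{S_j}$; for $S=S_1+S_2$: $\neg[\mathsf{in}_j]\varphi\to[\mathsf{in}_j]\neg\varphi$ and $\neg[\mathsf{in}_1]\bot_{S_1}\leftrightarrow[\mathsf{in}_2]\bot_{S_2}$; for $S=Id$, $\varphi:T$: $\neg[\mathsf{next}]\varphi\to[\mathsf{next}]\neg\varphi$ and $\neg[\mathsf{next}]\bot_T$; for $S=\Delta^*S'$, $\varphi,\psi::S'$, $p,q\in[0,1]$: $\mathsf U_{\le p}\varphi\to\mathsf U_{<q}\varphi$ if $p<q$; $\mathsf U_{<p}\varphi\to\mathsf U_{\le p}\varphi$; $\mathsf L_{\ge1}(\varphi\to\psi)\to(\mathsf U_{\ge p}\varphi\to\mathsf U_{\ge p}\psi)$; $[(p,q)]\varphi\leftrightarrow(\mathsf U_{\ge p}\varphi\wedge\mathsf L_{\ge q}\varphi)$. *)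

theory Defs
  imports "HOL-Analysis.Analysis"
begin

section \<open>Uncertainty spaces and upper probabilities\<close>

text \<open>A space is a pair (points, measurable sets); \<^const>\<open>algebra\<close> expresses that the
  second component is a nonempty family of subsets closed under finite unions and complements.\<close>

type_synonym 'a uspace = "'a set \<times> 'a set set"

abbreviation points :: "'a uspace \<Rightarrow> 'a set" where "points \<equiv> fst"
abbreviation msets :: "'a uspace \<Rightarrow> 'a set set" where "msets \<equiv> snd"

definition uncertainty_space :: "'a uspace \<Rightarrow> bool" where
  "uncertainty_space A \<longleftrightarrow> algebra (points A) (msets A)"

definition measurable_map :: "'a uspace \<Rightarrow> 'b uspace \<Rightarrow> ('a \<Rightarrow> 'b) \<Rightarrow> bool" where
  "measurable_map A B f \<longleftrightarrow>
     f \<in> points A \<rightarrow> points B \<and> (\<forall>V \<in> msets B. f -` V \<inter> points A \<in> msets A)"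

definition probability :: "'a uspace \<Rightarrow> ('a set \<Rightarrow> real) \<Rightarrow> bool" where
  "probability A \<mu> \<longleftrightarrow>
     \<mu> \<in> msets A \<rightarrow> {0..1} \<and> \<mu> {} = 0 \<and> \<mu> (points A) = 1 \<and>
     (\<forall>U \<in> msets A. \<forall>V \<in> msets A. U \<inter> V = {} \<longrightarrow> \<mu> (U \<union> V) = \<mu> U + \<mu> V)"

text \<open>The extensional function space makes an upper probability measure determined by its values
  on measurable sets.\<close>

definition upper_probs :: "'a uspace \<Rightarrow> ('a set \<Rightarrow> real) set" where
  "upper_probs A =
     {g \<in> msets A \<rightarrow>\<^sub>E {0..1}. \<exists>P. P \<noteq> {} \<and> (\<forall>\<mu>\<in>P. probability A \<mu>) \<and>
        (\<forall>U \<in> msets A. g U = (SUP \<mu>\<in>P. \<mu> U))}"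

definition beta :: "'a uspace \<Rightarrow> real \<Rightarrow> real \<Rightarrow> 'a set \<Rightarrow> ('a set \<Rightarrow> real) set" where
  "beta A p q U = {g \<in> upper_probs A. g U \<ge> p \<and> 1 - g (points A - U) \<ge> q}"

definition delta_star :: "'a uspace \<Rightarrow> ('a set \<Rightarrow> real) uspace" where
  "delta_star A = (upper_probs A,
     algebra (upper_probs A) hull
       {beta A p q U | p q U. p \<in> {0..1} \<and> q \<in> {0..1} \<and> U \<in> msets A})"

definition prod_space :: "'a uspace \<Rightarrow> 'b uspace \<Rightarrow> ('a \<times> 'b) uspace" where
  "prod_space A B = (points A \<times> points B,
     algebra (points A \<times> points B) hull {U \<times> V | U V. U \<in> msets A \<and> V \<in> msets B})"

definition sum_space :: "'a uspace \<Rightarrow> 'b uspace \<Rightarrow> ('a + 'b) uspace" where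
  "sum_space A B = (points A <+> points B,
     algebra (points A <+> points B) hull ((`) Inl ` msets A \<union> (`) Inr ` msets B))"

text \<open>Copy of a space along a function that is injective on its points.\<close>

definition transport :: "('a \<Rightarrow> 'b) \<Rightarrow> 'a uspace \<Rightarrow> 'b uspace" where
  "transport f A = (f ` points A, (`) f ` msets A)"


section \<open>Upper probability polynomial functors\<close>

datatype 'm pfunctor =
    Idf
  | Constf "'m uspace"
  | Prodf "'m pfunctor" "'m pfunctor"
  | Sumf "'m pfunctor" "'m pfunctor"
  | Deltaf "'m pfunctor"

primrec upper_prob_polynomial :: "'m pfunctor \<Rightarrow> bool" where
  "upper_prob_polynomial Idf \<longleftrightarrow> True"
| "upper_prob_polynomial (Constf M) \<longleftrightarrow> uncertainty_space M"
| "upper_prob_polynomial (Prodf S1 S2) \<longleftrightarrow> upper_prob_polynomial S1 \<and> upper_prob_polynomial S2"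
| "upper_prob_polynomial (Sumf S1 S2) \<longleftrightarrow> upper_prob_polynomial S1 \<and> upper_prob_polynomial S2"
| "upper_prob_polynomial (Deltaf S) \<longleftrightarrow> upper_prob_polynomial S"

primrec Ing :: "'m pfunctor \<Rightarrow> 'm pfunctor set" where
  "Ing Idf = {Idf}"
| "Ing (Constf M) = {Constf M, Idf}"
| "Ing (Prodf S1 S2) = {Prodf S1 S2} \<union> Ing S1 \<union> Ing S2"
| "Ing (Sumf S1 S2) = {Sumf S1 S2} \<union> Ing S1 \<union> Ing S2"
| "Ing (Deltaf S) = {Deltaf S} \<union> Ing S"

text \<open>All the spaces \<open>S X\<close>, for varying \<open>S\<close>, have to live in one type, and \<open>\<Delta>\<^sup>*\<close>
  would make that type recurse through set functions. However, each algebra involved is generated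
  by explicit sets, so every measurable set of \<open>S X\<close> is the trace \<open>decode c \<inter> S X\<close> of a set
  denoted by an expression \<open>c\<close> from the type \<open>code\<close>, which does not mention the values. An upper
  probability measure \<open>g\<close> is stored as \<open>c \<mapsto> g (decode c \<inter> S X)\<close>; this is injective
  (\<open>inj_on_upV\<close> and \<open>inj_on_upV_obj\<close> below), so the spaces \<open>obj X S\<close> are isomorphic copies of the
  constructions of the previous section.\<close>

datatype ('x, 'm) code =
    CState "'x set"
  | CConst "'m set"
  | CRect "('x, 'm) code" "('x, 'm) code"
  | CInl "('x, 'm) code"
  | CInr "('x, 'm) code"
  | CBeta real real "('x, 'm) code"
  | CUn "('x, 'm) code" "('x, 'm) code"
  | CCompl "('x, 'm) code"

datatype ('x, 'm) val =
    StateV 'x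
  | ConstV 'm
  | PairV "('x, 'm) val" "('x, 'm) val"
  | InlV "('x, 'm) val"
  | InrV "('x, 'm) val"
  | UpV "('x, 'm) code \<Rightarrow> real"

primrec decode :: "('x, 'm) code \<Rightarrow> ('x, 'm) val set" where
  "decode (CState U) = StateV ` U"
| "decode (CConst U) = ConstV ` U"
| "decode (CRect c d) = {PairV u v | u v. u \<in> decode c \<and> v \<in> decode d}"
| "decode (CInl c) = InlV ` decode c"
| "decode (CInr c) = InrV ` decode c"
| "decode (CBeta p q c) = {UpV h | h. h c \<ge> p \<and> 1 - h (CCompl c) \<ge> q}"
| "decode (CUn c d) = decode c \<union> decode d"
| "decode (CCompl c) = - decode c"

definition pairV :: "('x, 'm) val \<times> ('x, 'm) val \<Rightarrow> ('x, 'm) val" where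
  "pairV = (\<lambda>(u, v). PairV u v)"

definition sumV :: "('x, 'm) val + ('x, 'm) val \<Rightarrow> ('x, 'm) val" where
  "sumV = case_sum InlV InrV"

definition upV :: "('x, 'm) val uspace \<Rightarrow> (('x, 'm) val set \<Rightarrow> real) \<Rightarrow> ('x, 'm) val" where
  "upV A g = UpV (\<lambda>c. g (decode c \<inter> points A))"

primrec obj :: "'x uspace \<Rightarrow> 'm pfunctor \<Rightarrow> ('x, 'm) val uspace" where
  "obj X Idf = transport StateV X"
| "obj X (Constf M) = transport ConstV M"
| "obj X (Prodf S1 S2) = transport pairV (prod_space (obj X S1) (obj X S2))"
| "obj X (Sumf S1 S2) = transport sumV (sum_space (obj X S1) (obj X S2))"
| "obj X (Deltaf S) = transport (upV (obj X S)) (delta_star (obj X S))"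

definition coalgebra :: "'m pfunctor \<Rightarrow> 'x uspace \<Rightarrow> ('x \<Rightarrow> ('x, 'm) val) \<Rightarrow> bool" where
  "coalgebra T X \<alpha> \<longleftrightarrow> uncertainty_space X \<and> measurable_map X (obj X T) \<alpha>"


section \<open>Formulas\<close>

datatype 'm form =
    Bot
  | Imp "'m form" "'m form"
  | Cst "'m uspace" "'m set"
  | Pr1 "'m form"
  | Pr2 "'m form"
  | In1 "'m form"
  | In2 "'m form"
  | Next "'m form"
  | Mod real real "'m form"

abbreviation Neg :: "'m form \<Rightarrow> 'm form" where "Neg \<phi> \<equiv> Imp \<phi> Bot"
abbreviation Con :: "'m form \<Rightarrow> 'm form \<Rightarrow> 'm form" where "Con \<phi> \<psi> \<equiv> Neg (Imp \<phi> (Neg \<psi>))"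
abbreviation Iff :: "'m form \<Rightarrow> 'm form \<Rightarrow> 'm form" where "Iff \<phi> \<psi> \<equiv> Con (Imp \<phi> \<psi>) (Imp \<psi> \<phi>)"
abbreviation U_ge :: "real \<Rightarrow> 'm form \<Rightarrow> 'm form" where "U_ge p \<phi> \<equiv> Mod p 0 \<phi>"
abbreviation L_ge :: "real \<Rightarrow> 'm form \<Rightarrow> 'm form" where "L_ge p \<phi> \<equiv> Mod 0 p \<phi>"
abbreviation U_le :: "real \<Rightarrow> 'm form \<Rightarrow> 'm form" where "U_le p \<phi> \<equiv> Mod 0 (1 - p) (Neg \<phi>)"
abbreviation U_lt :: "real \<Rightarrow> 'm form \<Rightarrow> 'm form" where "U_lt p \<phi> \<equiv> Neg (U_ge p \<phi>)"

text \<open>\<open>consts_measurable \<phi>\<close> together with \<open>\<phi> : S\<close> is the judgement \<open>\<phi> :: S\<close>.\<close>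

primrec consts_measurable :: "'m form \<Rightarrow> bool" where
  "consts_measurable Bot \<longleftrightarrow> True"
| "consts_measurable (Imp \<phi> \<psi>) \<longleftrightarrow> consts_measurable \<phi> \<and> consts_measurable \<psi>"
| "consts_measurable (Cst M A) \<longleftrightarrow> A \<in> msets M"
| "consts_measurable (Pr1 \<phi>) \<longleftrightarrow> consts_measurable \<phi>"
| "consts_measurable (Pr2 \<phi>) \<longleftrightarrow> consts_measurable \<phi>"
| "consts_measurable (In1 \<phi>) \<longleftrightarrow> consts_measurable \<phi>"
| "consts_measurable (In2 \<phi>) \<longleftrightarrow> consts_measurable \<phi>"
| "consts_measurable (Next \<phi>) \<longleftrightarrow> consts_measurable \<phi>"
| "consts_measurable (Mod p q \<phi>) \<longleftrightarrow> consts_measurable \<phi>"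

text \<open>\<open>has_sort T \<phi> S\<close> is the judgement \<open>\<phi> : S\<close> for the language of \<open>T\<close>. The falsum is not
  annotated with its sort: it belongs to every sort, and all semantic notions take the sort as a
  parameter.\<close>

inductive has_sort :: "'m pfunctor \<Rightarrow> 'm form \<Rightarrow> 'm pfunctor \<Rightarrow> bool" for T where
  bot: "S \<in> Ing T \<Longrightarrow> has_sort T Bot S"
| imp: "has_sort T \<phi> S \<Longrightarrow> has_sort T \<psi> S \<Longrightarrow> has_sort T (Imp \<phi> \<psi>) S"
| cst: "Constf M \<in> Ing T \<Longrightarrow> A \<in> msets M \<or> (\<exists>m \<in> points M. A = {m}) \<Longrightarrow>
    has_sort T (Cst M A) (Constf M)"
| pr1: "Prodf S1 S2 \<in> Ing T \<Longrightarrow> has_sort T \<phi> S1 \<Longrightarrow> has_sort T (Pr1 \<phi>) (Prodf S1 S2)"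
| pr2: "Prodf S1 S2 \<in> Ing T \<Longrightarrow> has_sort T \<phi> S2 \<Longrightarrow> has_sort T (Pr2 \<phi>) (Prodf S1 S2)"
| in1: "Sumf S1 S2 \<in> Ing T \<Longrightarrow> has_sort T \<phi> S1 \<Longrightarrow> has_sort T (In1 \<phi>) (Sumf S1 S2)"
| in2: "Sumf S1 S2 \<in> Ing T \<Longrightarrow> has_sort T \<phi> S2 \<Longrightarrow> has_sort T (In2 \<phi>) (Sumf S1 S2)"
| next_step: "has_sort T \<phi> T \<Longrightarrow> has_sort T (Next \<phi>) Idf"
| modal: "Deltaf S \<in> Ing T \<Longrightarrow> p \<in> {0..1} \<Longrightarrow> q \<in> {0..1} \<Longrightarrow>
    has_sort T \<phi> S \<Longrightarrow> consts_measurable \<phi> \<Longrightarrow> has_sort T (Mod p q \<phi>) (Deltaf S)"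

text \<open>The value is irrelevant when \<open>\<phi>\<close> is not of sort \<open>S\<close>.\<close>

fun sem :: "'m pfunctor \<Rightarrow> 'x uspace \<Rightarrow> ('x \<Rightarrow> ('x, 'm) val) \<Rightarrow> 'm pfunctor \<Rightarrow> 'm form \<Rightarrow>
    ('x, 'm) val set" where
  "sem T X \<alpha> S Bot = {}"
| "sem T X \<alpha> S (Imp \<phi> \<psi>) = (points (obj X S) - sem T X \<alpha> S \<phi>) \<union> sem T X \<alpha> S \<psi>"
| "sem T X \<alpha> (Constf _) (Cst _ A) = ConstV ` A"
| "sem T X \<alpha> (Prodf S1 S2) (Pr1 \<phi>) =
     pairV ` {z \<in> points (obj X S1) \<times> points (obj X S2). fst z \<in> sem T X \<alpha> S1 \<phi>}"
| "sem T X \<alpha> (Prodf S1 S2) (Pr2 \<phi>) =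
     pairV ` {z \<in> points (obj X S1) \<times> points (obj X S2). snd z \<in> sem T X \<alpha> S2 \<phi>}"
| "sem T X \<alpha> (Sumf S1 S2) (In1 \<phi>) = InlV ` sem T X \<alpha> S1 \<phi> \<union> InrV ` points (obj X S2)"
| "sem T X \<alpha> (Sumf S1 S2) (In2 \<phi>) = InlV ` points (obj X S1) \<union> InrV ` sem T X \<alpha> S2 \<phi>"
| "sem T X \<alpha> Idf (Next \<phi>) = StateV ` {x \<in> points X. \<alpha> x \<in> sem T X \<alpha> T \<phi>}"
| "sem T X \<alpha> (Deltaf S) (Mod p q \<phi>) = upV (obj X S) ` beta (obj X S) p q (sem T X \<alpha> S \<phi>)"
| "sem T X \<alpha> _ _ = {}"


section \<open>Axioms\<close>

text \<open>A Boolean tautology holds under every assignment of truth values to the formulas that are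
  neither the falsum nor implications.\<close>

fun truth :: "('m form \<Rightarrow> bool) \<Rightarrow> 'm form \<Rightarrow> bool" where
  "truth v Bot \<longleftrightarrow> False"
| "truth v (Imp \<phi> \<psi>) \<longleftrightarrow> (truth v \<phi> \<longrightarrow> truth v \<psi>)"
| "truth v \<phi> \<longleftrightarrow> v \<phi>"

definition tautology :: "'m form \<Rightarrow> bool" where
  "tautology \<phi> \<longleftrightarrow> (\<forall>v. truth v \<phi>)"

inductive_set Ax :: "'m pfunctor \<Rightarrow> 'm pfunctor \<Rightarrow> 'm form set" for T S where
  taut: "has_sort T \<phi> S \<Longrightarrow> tautology \<phi> \<Longrightarrow> \<phi> \<in> Ax T S"
| const_in: "S = Constf M \<Longrightarrow> c \<in> points M \<Longrightarrow> has_sort T (Cst M A) S \<Longrightarrow> c \<in> A \<Longrightarrow>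
    Imp (Cst M {c}) (Cst M A) \<in> Ax T S"
| const_notin: "S = Constf M \<Longrightarrow> c \<in> points M \<Longrightarrow> has_sort T (Cst M A) S \<Longrightarrow> c \<notin> A \<Longrightarrow>
    Imp (Cst M {c}) (Neg (Cst M A)) \<in> Ax T S"
| pr1_neg: "S = Prodf S1 S2 \<Longrightarrow> has_sort T \<phi> S1 \<Longrightarrow> Imp (Neg (Pr1 \<phi>)) (Pr1 (Neg \<phi>)) \<in> Ax T S"
| pr2_neg: "S = Prodf S1 S2 \<Longrightarrow> has_sort T \<phi> S2 \<Longrightarrow> Imp (Neg (Pr2 \<phi>)) (Pr2 (Neg \<phi>)) \<in> Ax T S"
| pr1_bot: "S = Prodf S1 S2 \<Longrightarrow> Neg (Pr1 Bot) \<in> Ax T S"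
| pr2_bot: "S = Prodf S1 S2 \<Longrightarrow> Neg (Pr2 Bot) \<in> Ax T S"
| in1_neg: "S = Sumf S1 S2 \<Longrightarrow> has_sort T \<phi> S1 \<Longrightarrow> Imp (Neg (In1 \<phi>)) (In1 (Neg \<phi>)) \<in> Ax T S"
| in2_neg: "S = Sumf S1 S2 \<Longrightarrow> has_sort T \<phi> S2 \<Longrightarrow> Imp (Neg (In2 \<phi>)) (In2 (Neg \<phi>)) \<in> Ax T S"
| in_bot: "S = Sumf S1 S2 \<Longrightarrow> Iff (Neg (In1 Bot)) (In2 Bot) \<in> Ax T S"
| next_neg: "S = Idf \<Longrightarrow> has_sort T \<phi> T \<Longrightarrow> Imp (Neg (Next \<phi>)) (Next (Neg \<phi>)) \<in> Ax T S"
| next_bot: "S = Idf \<Longrightarrow> Neg (Next Bot) \<in> Ax T S"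
| U_le_lt: "S = Deltaf S' \<Longrightarrow> has_sort T \<phi> S' \<Longrightarrow> consts_measurable \<phi> \<Longrightarrow>
    p \<in> {0..1} \<Longrightarrow> q \<in> {0..1} \<Longrightarrow> p < q \<Longrightarrow> Imp (U_le p \<phi>) (U_lt q \<phi>) \<in> Ax T S"
| U_lt_le: "S = Deltaf S' \<Longrightarrow> has_sort T \<phi> S' \<Longrightarrow> consts_measurable \<phi> \<Longrightarrow>
    p \<in> {0..1} \<Longrightarrow> Imp (U_lt p \<phi>) (U_le p \<phi>) \<in> Ax T S"
| L_imp: "S = Deltaf S' \<Longrightarrow> has_sort T \<phi> S' \<Longrightarrow> consts_measurable \<phi> \<Longrightarrow>
    has_sort T \<psi> S' \<Longrightarrow> consts_measurable \<psi> \<Longrightarrow> p \<in> {0..1} \<Longrightarrow>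
    Imp (L_ge 1 (Imp \<phi> \<psi>)) (Imp (U_ge p \<phi>) (U_ge p \<psi>)) \<in> Ax T S"
| mod_split: "S = Deltaf S' \<Longrightarrow> has_sort T \<phi> S' \<Longrightarrow> consts_measurable \<phi> \<Longrightarrow>
    p \<in> {0..1} \<Longrightarrow> q \<in> {0..1} \<Longrightarrow>
    Iff (Mod p q \<phi>) (Con (U_ge p \<phi>) (L_ge q \<phi>)) \<in> Ax T S"


section \<open>Adequacy of the encoding\<close>

lemma algebra_hull:
  assumes "G \<subseteq> Pow \<Omega>"
  shows "algebra \<Omega> (algebra \<Omega> hull G)"
proof -
  have mem: "U \<in> algebra \<Omega> hull G \<longleftrightarrow> (\<forall>N. algebra \<Omega> N \<longrightarrow> G \<subseteq> N \<longrightarrow> U \<in> N)" for U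
    unfolding hull_def by blast
  have "algebra \<Omega> (Pow \<Omega>)" by (simp add: algebra_iff_Un)
  then have sub: "algebra \<Omega> hull G \<subseteq> Pow \<Omega>"
    using assms mem by blast
  show ?thesis
  proof (rule algebra_iff_Un[THEN iffD2], intro conjI ballI)
    show "{} \<in> algebra \<Omega> hull G"
      unfolding mem by (simp add: algebra_iff_Un)
    show "\<Omega> - U \<in> algebra \<Omega> hull G" if "U \<in> algebra \<Omega> hull G" for U
      using that unfolding mem by (simp add: algebra_iff_Un)
    show "U \<union> V \<in> algebra \<Omega> hull G"
      if "U \<in> algebra \<Omega> hull G" "V \<in> algebra \<Omega> hull G" for U V
      using that unfolding mem by (simp add: algebra_iff_Un)
  qed (rule sub)
qed

lemma algebra_transport:
  assumes "uncertainty_space A" "inj_on f (points A)"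
  shows "uncertainty_space (transport f A)"
proof -
  have sub: "\<And>U. U \<in> msets A \<Longrightarrow> U \<subseteq> points A" "{} \<in> msets A"
      "\<And>U. U \<in> msets A \<Longrightarrow> points A - U \<in> msets A"
      "\<And>U V. U \<in> msets A \<Longrightarrow> V \<in> msets A \<Longrightarrow> U \<union> V \<in> msets A"
    using assms(1) by (auto simp: uncertainty_space_def algebra_iff_Un)
  have "f ` points A - f ` U = f ` (points A - U)" if "U \<in> msets A" for U
    using inj_on_image_set_diff[OF assms(2), of "points A" U] sub(1)[OF that] by auto
  note diff = this
  show ?thesis
    unfolding uncertainty_space_def transport_def algebra_iff_Un fst_conv snd_conv
  proof (intro conjI ballI)
    show "(`) f ` msets A \<subseteq> Pow (f ` points A)" using sub(1) by blast
    show "{} \<in> (`) f ` msets A" using sub(2) by force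
    show "f ` points A - V \<in> (`) f ` msets A"
      if "V \<in> (`) f ` msets A" for V
      using that sub(3) diff by auto
    show "V \<union> W \<in> (`) f ` msets A" if "V \<in> (`) f ` msets A" "W \<in> (`) f ` msets A" for V W
      using that sub(4) by (auto simp: image_Un[symmetric])
  qed
qed

lemma inj_on_upV:
  assumes "\<And>U. U \<in> msets A \<Longrightarrow> \<exists>c. U = decode c \<inter> points A"
  shows "inj_on (upV A) (upper_probs A)"
proof (rule inj_onI)
  fix g h assume g: "g \<in> upper_probs A" and h: "h \<in> upper_probs A" and eq: "upV A g = upV A h"
  have "g U = h U" if U: "U \<in> msets A" for U
  proof -
    obtain c where c: "U = decode c \<inter> points A" using assms[OF U] by blast
    have "(\<lambda>c. g (decode c \<inter> points A)) = (\<lambda>c. h (decode c \<inter> points A))"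
      using eq by (simp only: upV_def val.inject)
    from fun_cong[OF this, of c] show ?thesis by (simp only: c)
  qed
  then show "g = h"
    using g h by (intro extensionalityI[of g "msets A" h]) (auto simp: upper_probs_def PiE_def)
qed

lemma inj_pairV: "inj pairV" and inj_sumV: "inj sumV"
  by (auto simp: inj_def pairV_def sumV_def split: sum.splits)

text \<open>Sets that are traces of codes, after transport along \<open>f\<close>, form an algebra.\<close>

lemma algebra_coded:
  assumes "inj_on f \<Omega>"
  shows "algebra \<Omega> {U. U \<subseteq> \<Omega> \<and> (\<exists>c. f ` U = decode c \<inter> f ` \<Omega>)}"
proof -
  have empty: "f ` {} = decode (CState {}) \<inter> f ` \<Omega>" by simp
  have compl: "f ` (\<Omega> - U) = decode (CCompl c) \<inter> f ` \<Omega>"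
    if "U \<subseteq> \<Omega>" "f ` U = decode c \<inter> f ` \<Omega>" for U c
  proof -
    have "f ` (\<Omega> - U) = f ` \<Omega> - f ` U"
      using inj_on_image_set_diff[OF assms, of \<Omega> U] that(1) by blast
    also have "\<dots> = decode (CCompl c) \<inter> f ` \<Omega>"
      unfolding that(2) decode.simps by blast
    finally show ?thesis .
  qed
  have un: "f ` (U \<union> V) = decode (CUn c d) \<inter> f ` \<Omega>"
    if "f ` U = decode c \<inter> f ` \<Omega>" "f ` V = decode d \<inter> f ` \<Omega>" for U V c d
    unfolding image_Un that decode.simps by blast
  show ?thesis
  proof (rule algebra_iff_Un[THEN iffD2], intro conjI ballI)
    show "{} \<in> {U. U \<subseteq> \<Omega> \<and> (\<exists>c. f ` U = decode c \<inter> f ` \<Omega>)}"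
      by (intro CollectI conjI exI[of _ "CState {}"] empty empty_subsetI)
    show "\<Omega> - U \<in> {U. U \<subseteq> \<Omega> \<and> (\<exists>c. f ` U = decode c \<inter> f ` \<Omega>)}"
      if U: "U \<in> {U. U \<subseteq> \<Omega> \<and> (\<exists>c. f ` U = decode c \<inter> f ` \<Omega>)}" for U
    proof -
      obtain c where "U \<subseteq> \<Omega>" "f ` U = decode c \<inter> f ` \<Omega>"
        using U by (elim CollectE conjE exE) (rule that)
      then show ?thesis
        by (intro CollectI conjI exI[of _ "CCompl c"] compl Diff_subset)
    qed
    show "U \<union> V \<in> {U. U \<subseteq> \<Omega> \<and> (\<exists>c. f ` U = decode c \<inter> f ` \<Omega>)}"
      if UV: "U \<in> {U. U \<subseteq> \<Omega> \<and> (\<exists>c. f ` U = decode c \<inter> f ` \<Omega>)}"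
        "V \<in> {U. U \<subseteq> \<Omega> \<and> (\<exists>c. f ` U = decode c \<inter> f ` \<Omega>)}" for U V
    proof -
      obtain c d where "U \<subseteq> \<Omega>" "V \<subseteq> \<Omega>" "f ` U = decode c \<inter> f ` \<Omega>" "f ` V = decode d \<inter> f ` \<Omega>"
        using UV by (elim CollectE conjE exE) (rule that)
      then show ?thesis
        by (intro CollectI conjI exI[of _ "CUn c d"] un Un_least)
    qed
  qed blast
qed

lemma coded_hull:
  assumes "inj_on f \<Omega>" "G \<subseteq> Pow \<Omega>" "\<And>U. U \<in> G \<Longrightarrow> \<exists>c. f ` U = decode c \<inter> f ` \<Omega>"
    and "U \<in> algebra \<Omega> hull G"
  shows "\<exists>c. f ` U = decode c \<inter> f ` \<Omega>"
proof -
  have "G \<subseteq> {U. U \<subseteq> \<Omega> \<and> (\<exists>c. f ` U = decode c \<inter> f ` \<Omega>)}"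
    using assms(2) by (intro subsetI CollectI conjI assms(3)) auto
  from hull_minimal[of G _ "algebra \<Omega>", OF this algebra_coded[OF assms(1)]]
  have "U \<in> {U. U \<subseteq> \<Omega> \<and> (\<exists>c. f ` U = decode c \<inter> f ` \<Omega>)}" using assms(4) by (rule subsetD)
  then show ?thesis by (elim CollectE conjE)
qed

lemma msets_subset:
  assumes "uncertainty_space A" "U \<in> msets A"
  shows "U \<subseteq> points A"
  using assms algebra_iff_Un[of "points A" "msets A"] by (auto simp: uncertainty_space_def)

lemma rects_subset:
  assumes "uncertainty_space A" "uncertainty_space B"
  shows "{U \<times> V | U V. U \<in> msets A \<and> V \<in> msets B} \<subseteq> Pow (points A \<times> points B)"
  using msets_subset[OF assms(1)] msets_subset[OF assms(2)] by (clarsimp intro!: Sigma_mono) auto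

lemma injections_subset:
  assumes "uncertainty_space A" "uncertainty_space B"
  shows "(`) Inl ` msets A \<union> (`) Inr ` msets B \<subseteq> Pow (points A <+> points B)"
  using msets_subset[OF assms(1)] msets_subset[OF assms(2)] unfolding Plus_def
  by (fastforce dest: subsetD)

lemma uncertainty_space_prod:
  assumes "uncertainty_space A" "uncertainty_space B"
  shows "uncertainty_space (prod_space A B)"
  using algebra_hull[OF rects_subset[OF assms]] by (simp add: uncertainty_space_def prod_space_def)

lemma uncertainty_space_sum:
  assumes "uncertainty_space A" "uncertainty_space B"
  shows "uncertainty_space (sum_space A B)"
  using algebra_hull[OF injections_subset[OF assms]]
  by (simp add: uncertainty_space_def sum_space_def)

lemma uncertainty_space_delta_star: "uncertainty_space (delta_star A)"
proof -
  have "{beta A p q U | p q U. p \<in> {0..1} \<and> q \<in> {0..1} \<and> U \<in> msets A} \<subseteq> Pow (upper_probs A)"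
    unfolding beta_def by blast
  from algebra_hull[OF this] show ?thesis
    by (simp add: uncertainty_space_def delta_star_def)
qed

lemma coded_transport:
  assumes "uncertainty_space A" "inj_on f (points A)"
    and "\<And>U. U \<in> msets A \<Longrightarrow> \<exists>c. f ` U = decode c \<inter> f ` points A"
  shows "uncertainty_space (transport f A) \<and>
    (\<forall>V \<in> msets (transport f A). \<exists>c. V = decode c \<inter> points (transport f A))"
proof (intro conjI ballI)
  show "uncertainty_space (transport f A)" by (rule algebra_transport[OF assms(1,2)])
  fix V assume "V \<in> msets (transport f A)"
  then obtain U where "U \<in> msets A" "V = f ` U" by (auto simp: transport_def)
  then show "\<exists>c. V = decode c \<inter> points (transport f A)"
    using assms(3)[of U] by (simp add: transport_def)
qed

lemma obj_coded:
  assumes "uncertainty_space X" "upper_prob_polynomial S"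
  shows "uncertainty_space (obj X S) \<and>
    (\<forall>U \<in> msets (obj X S). \<exists>c. U = decode c \<inter> points (obj X S))"
  using assms(2)
proof (induction S)
  case Idf
  have "\<exists>c. StateV ` U = decode c \<inter> StateV ` points X" if "U \<in> msets X" for U
    using msets_subset[OF _ that] assms(1) by (intro exI[of _ "CState U"]) auto
  from coded_transport[OF _ _ this] show ?case
    using assms(1) by (simp add: inj_on_def)
next
  case (Constf M)
  have "\<exists>c. ConstV ` U = decode c \<inter> ConstV ` points M" if "U \<in> msets M" for U
    using msets_subset[OF _ that] Constf by (intro exI[of _ "CConst U"]) auto
  from coded_transport[OF _ _ this] show ?case
    using Constf by (simp add: inj_on_def)
next
  case (Prodf S1 S2)
  let ?A = "obj X S1" and ?B = "obj X S2"
  have A: "uncertainty_space ?A" "\<And>U. U \<in> msets ?A \<Longrightarrow> \<exists>c. U = decode c \<inter> points ?A"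
    and B: "uncertainty_space ?B" "\<And>U. U \<in> msets ?B \<Longrightarrow> \<exists>c. U = decode c \<inter> points ?B"
    using Prodf by auto
  have inj: "inj_on pairV W" for W :: "(('a, 'b) val \<times> ('a, 'b) val) set"
    using inj_pairV by (auto intro: inj_on_subset)
  have "\<exists>c. pairV ` W = decode c \<inter> pairV ` (points ?A \<times> points ?B)"
    if W: "W \<in> msets (prod_space ?A ?B)" for W
  proof (rule coded_hull[OF inj])
    show "W \<in> algebra (points ?A \<times> points ?B) hull {U \<times> V | U V. U \<in> msets ?A \<and> V \<in> msets ?B}"
      using W by (simp add: prod_space_def)
    show "{U \<times> V | U V. U \<in> msets ?A \<and> V \<in> msets ?B} \<subseteq> Pow (points ?A \<times> points ?B)"
      by (rule rects_subset[OF A(1) B(1)])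
    fix R assume "R \<in> {U \<times> V | U V. U \<in> msets ?A \<and> V \<in> msets ?B}"
    then obtain U V where "R = U \<times> V" "U \<in> msets ?A" "V \<in> msets ?B" by auto
    moreover obtain c where "U = decode c \<inter> points ?A"
      using A(2)[OF \<open>U \<in> msets ?A\<close>] by (rule exE)
    moreover obtain d where "V = decode d \<inter> points ?B"
      using B(2)[OF \<open>V \<in> msets ?B\<close>] by (rule exE)
    ultimately have "pairV ` R = decode (CRect c d) \<inter> pairV ` (points ?A \<times> points ?B)"
      by (auto simp: pairV_def)
    then show "\<exists>c. pairV ` R = decode c \<inter> pairV ` (points ?A \<times> points ?B)" by (rule exI)
  qed
  then show ?case
    using coded_transport[OF uncertainty_space_prod[OF A(1) B(1)] inj]
    by (simp add: prod_space_def)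
next
  case (Sumf S1 S2)
  let ?A = "obj X S1" and ?B = "obj X S2"
  have A: "uncertainty_space ?A" "\<And>U. U \<in> msets ?A \<Longrightarrow> \<exists>c. U = decode c \<inter> points ?A"
    and B: "uncertainty_space ?B" "\<And>U. U \<in> msets ?B \<Longrightarrow> \<exists>c. U = decode c \<inter> points ?B"
    using Sumf by auto
  have inj: "inj_on sumV W" for W :: "(('a, 'b) val + ('a, 'b) val) set"
    using inj_sumV by (auto intro: inj_on_subset)
  have "\<exists>c. sumV ` W = decode c \<inter> sumV ` (points ?A <+> points ?B)"
    if W: "W \<in> msets (sum_space ?A ?B)" for W
  proof (rule coded_hull[OF inj])
    show "W \<in> algebra (points ?A <+> points ?B) hull ((`) Inl ` msets ?A \<union> (`) Inr ` msets ?B)"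
      using W by (simp add: sum_space_def)
    show "(`) Inl ` msets ?A \<union> (`) Inr ` msets ?B \<subseteq> Pow (points ?A <+> points ?B)"
      by (rule injections_subset[OF A(1) B(1)])
    fix R assume "R \<in> (`) Inl ` msets ?A \<union> (`) Inr ` msets ?B"
    then consider U where "U \<in> msets ?A" "R = Inl ` U" | V where "V \<in> msets ?B" "R = Inr ` V" by auto
    then show "\<exists>c. sumV ` R = decode c \<inter> sumV ` (points ?A <+> points ?B)"
    proof cases
      case 1
      obtain c where "U = decode c \<inter> points ?A" using A(2)[OF 1(1)] by (rule exE)
      then have "sumV ` R = decode (CInl c) \<inter> sumV ` (points ?A <+> points ?B)"
        using 1 by (auto simp: sumV_def image_image image_Un Plus_def)
      then show ?thesis by (rule exI)
    next
      case 2
      obtain c where "V = decode c \<inter> points ?B" using B(2)[OF 2(1)] by (rule exE)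
      then have "sumV ` R = decode (CInr c) \<inter> sumV ` (points ?A <+> points ?B)"
        using 2 by (auto simp: sumV_def image_image image_Un Plus_def)
      then show ?thesis by (rule exI)
    qed
  qed
  then show ?case
    using coded_transport[OF uncertainty_space_sum[OF A(1) B(1)] inj]
    by (simp add: sum_space_def)
next
  case (Deltaf S)
  let ?A = "obj X S"
  have A: "\<And>U. U \<in> msets ?A \<Longrightarrow> \<exists>c. U = decode c \<inter> points ?A"
    using Deltaf by auto
  have inj: "inj_on (upV ?A) (upper_probs ?A)"
    by (rule inj_on_upV[OF A])
  have "\<exists>c. upV ?A ` W = decode c \<inter> upV ?A ` upper_probs ?A"
    if W: "W \<in> msets (delta_star ?A)" for W
  proof (rule coded_hull[OF inj])
    show "W \<in> algebra (upper_probs ?A) hull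
       {beta ?A p q U | p q U. p \<in> {0..1} \<and> q \<in> {0..1} \<and> U \<in> msets ?A}"
      using W by (simp add: delta_star_def)
    show "{beta ?A p q U | p q U. p \<in> {0..1} \<and> q \<in> {0..1} \<and> U \<in> msets ?A} \<subseteq> Pow (upper_probs ?A)"
      by (auto simp: beta_def)
    fix R assume "R \<in> {beta ?A p q U | p q U. p \<in> {0..1} \<and> q \<in> {0..1} \<and> U \<in> msets ?A}"
    then obtain p q U where R: "R = beta ?A p q U" "U \<in> msets ?A" by auto
    obtain c where c: "U = decode c \<inter> points ?A" using A[OF R(2)] by (rule exE)
    then have "points ?A - U = decode (CCompl c) \<inter> points ?A" by auto
    then have "upV ?A ` R = decode (CBeta p q c) \<inter> upV ?A ` upper_probs ?A"
      using R(1) c by (auto simp: beta_def upV_def)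
    then show "\<exists>c. upV ?A ` R = decode c \<inter> upV ?A ` upper_probs ?A" by (rule exI)
  qed
  then show ?case
    using coded_transport[OF uncertainty_space_delta_star, of "upV ?A" ?A] inj
    by (simp add: delta_star_def)
qed

theorem inj_on_upV_obj:
  assumes "uncertainty_space X" "upper_prob_polynomial S"
  shows "inj_on (upV (obj X S)) (points (delta_star (obj X S)))"
  using obj_coded[OF assms] by (auto simp: delta_star_def intro!: inj_on_upV)

end

(* Each axiom is checked pointwise. Only the modal axioms need an argument: since every
   definable set is measurable, they reduce to the facts that an upper probability takes
   values in [0,1] and that g U \<le> g (U - V) + g V, which holds for each finitely additive
   probability and passes to suprema. *)

theory Submission
  imports Defs
begin

section \<open>Algebras and upper probabilities\<close>

lemma uncertainty_spaceD:
  assumes "uncertainty_space A"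
  shows "{} \<in> msets A" "points A \<in> msets A"
    and "U \<in> msets A \<Longrightarrow> points A - U \<in> msets A"
    and "U \<in> msets A \<Longrightarrow> V \<in> msets A \<Longrightarrow> U \<union> V \<in> msets A"
    and "U \<in> msets A \<Longrightarrow> V \<in> msets A \<Longrightarrow> U \<inter> V \<in> msets A"
    and "U \<in> msets A \<Longrightarrow> V \<in> msets A \<Longrightarrow> U - V \<in> msets A"
proof -
  interpret algebra "points A" "msets A"
    using assms by (simp add: uncertainty_space_def)
  show "{} \<in> msets A" "points A \<in> msets A"
    and "U \<in> msets A \<Longrightarrow> points A - U \<in> msets A"
    and "U \<in> msets A \<Longrightarrow> V \<in> msets A \<Longrightarrow> U \<union> V \<in> msets A"
    and "U \<in> msets A \<Longrightarrow> V \<in> msets A \<Longrightarrow> U \<inter> V \<in> msets A"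
    and "U \<in> msets A \<Longrightarrow> V \<in> msets A \<Longrightarrow> U - V \<in> msets A"
    by auto
qed

text \<open>Split \<open>U\<close> into \<open>U - V\<close> and \<open>U \<inter> V\<close>, and
  \<open>V\<close> into \<open>V - U\<close> and \<open>U \<inter> V\<close>. The common part
  cancels, and \<open>\<mu> (V - U)\<close> is nonnegative.\<close>

lemma probability_le_Diff:
  assumes "uncertainty_space A" "probability A \<mu>" "U \<in> msets A" "V \<in> msets A"
  shows "\<mu> U \<le> \<mu> (U - V) + \<mu> V"
proof -
  note closed = uncertainty_spaceD[OF assms(1)]
  have add: "\<mu> (B \<union> C) = \<mu> B + \<mu> C" if "B \<in> msets A" "C \<in> msets A" "B \<inter> C = {}" for B C
    using assms(2) that by (simp add: probability_def)
  have "\<mu> U = \<mu> ((U - V) \<union> (U \<inter> V))" by (simp add: Un_Diff_Int)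
  also have "\<dots> = \<mu> (U - V) + \<mu> (U \<inter> V)"
    using assms(3,4) by (intro add closed) auto
  finally have U: "\<mu> U = \<mu> (U - V) + \<mu> (U \<inter> V)" .
  have "\<mu> V = \<mu> ((V - U) \<union> (U \<inter> V))" by (rule arg_cong[of _ _ \<mu>]) blast
  also have "\<dots> = \<mu> (V - U) + \<mu> (U \<inter> V)"
    using assms(3,4) by (intro add closed) auto
  finally have V: "\<mu> V = \<mu> (V - U) + \<mu> (U \<inter> V)" .
  have "V - U \<in> msets A" using assms(3,4) by (intro closed)
  then have "0 \<le> \<mu> (V - U)"
    using assms(2) by (auto simp: probability_def Pi_iff)
  then show ?thesis using U V by simp
qed

lemma upper_probs_bounds:
  assumes "g \<in> upper_probs A" "U \<in> msets A"
  shows "0 \<le> g U" "g U \<le> 1"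
  using assms by (auto simp: upper_probs_def PiE_def Pi_iff)

text \<open>Every \<open>\<mu>\<close> in the family satisfies the same inequality and is dominated
  by \<open>g\<close> on measurable sets. The right-hand side therefore bounds every
  \<open>\<mu> U\<close>, hence their supremum.\<close>

lemma upper_probs_le_Diff:
  assumes "uncertainty_space A" "g \<in> upper_probs A" "U \<in> msets A" "V \<in> msets A"
  shows "g U \<le> g (U - V) + g V"
proof -
  obtain P where P: "P \<noteq> {}" "\<And>\<mu>. \<mu> \<in> P \<Longrightarrow> probability A \<mu>"
    and g: "\<And>W. W \<in> msets A \<Longrightarrow> g W = (SUP \<mu>\<in>P. \<mu> W)"
    using assms(2) by (auto simp: upper_probs_def)
  have le: "\<mu> W \<le> g W" if "\<mu> \<in> P" "W \<in> msets A" for \<mu> W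
    unfolding g[OF that(2)]
  proof (rule cSUP_upper[OF that(1)])
    \<comment> \<open>A real supremum dominates its family only when the family is bounded above;
      here 1 is a bound.\<close>
    show "bdd_above ((\<lambda>\<mu>. \<mu> W) ` P)"
      using P(2) that(2) by (intro bdd_aboveI2[of _ _ 1]) (auto simp: probability_def Pi_iff)
  qed
  have "U - V \<in> msets A"
    using uncertainty_spaceD(6)[OF assms(1,3,4)] .
  then have "\<mu> U \<le> g (U - V) + g V" if "\<mu> \<in> P" for \<mu>
    using probability_le_Diff[OF assms(1) P(2)[OF that] assms(3,4)] le[OF that] assms(4)
    by (meson add_mono order_trans)
  then show ?thesis
    unfolding g[OF assms(3)] by (rule cSUP_least[OF P(1)])
qed


section \<open>Well-sorted formulas denote (measurable) subsets\<close>

lemma Idf_in_Ing: "Idf \<in> Ing T"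
  by (induction T) auto

lemma Ing_trans:
  assumes "S \<in> Ing T" "R \<in> Ing S"
  shows "R \<in> Ing T"
  using assms by (induction T) (auto simp: Idf_in_Ing)

lemma Ing_refl: "T \<in> Ing T"
  by (cases T) auto

text \<open>Guarantees that component spaces are algebras and that \<open>Bot\<close> has every
  component sort.\<close>

lemma Ing_components:
  shows "Prodf S1 S2 \<in> Ing T \<Longrightarrow> S1 \<in> Ing T \<and> S2 \<in> Ing T"
    and "Sumf S1 S2 \<in> Ing T \<Longrightarrow> S1 \<in> Ing T \<and> S2 \<in> Ing T"
    and "Deltaf S \<in> Ing T \<Longrightarrow> S \<in> Ing T"
  by (auto elim: Ing_trans simp: Ing_refl)

lemma upper_prob_polynomial_Ing:
  assumes "upper_prob_polynomial T" "S \<in> Ing T"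
  shows "upper_prob_polynomial S"
  using assms by (induction T) auto

lemma has_sort_in_Ing: "has_sort T \<phi> S \<Longrightarrow> S \<in> Ing T"
  by (induction rule: has_sort.induct) (auto simp: Idf_in_Ing)

text \<open>Isolates the point sets, so that pointwise arguments can leave the generated algebras in
  \<open>obj\<close> folded.\<close>

lemma points_obj:
  shows "points (obj X Idf) = StateV ` points X"
    and "points (obj X (Constf M)) = ConstV ` points M"
    and "points (obj X (Prodf S1 S2)) = pairV ` (points (obj X S1) \<times> points (obj X S2))"
    and "points (obj X (Sumf S1 S2)) = InlV ` points (obj X S1) \<union> InrV ` points (obj X S2)"
    and "points (obj X (Deltaf S)) = upV (obj X S) ` upper_probs (obj X S)"
  by (simp_all add: transport_def prod_space_def sum_space_def delta_star_def sumV_def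
      Plus_def image_Un image_image)

text \<open>The assumption on \<open>T\<close> serves the constants: a measurable constant lies
  inside \<open>points M\<close> because the sets of \<open>M\<close> form an algebra there.\<close>

lemma sem_subset:
  assumes "upper_prob_polynomial T" "has_sort T \<phi> S"
  shows "sem T X \<alpha> S \<phi> \<subseteq> points (obj X S)"
  using assms(2)
proof (induction rule: has_sort.induct)
  case (cst M A)
  then have "uncertainty_space M"
    using upper_prob_polynomial_Ing[OF assms(1)] by fastforce
  then have "A \<subseteq> points M"
    using cst(2) msets_subset by blast
  then show ?case by (auto simp: points_obj simp del: obj.simps)
qed (auto simp: points_obj beta_def simp del: obj.simps)

text \<open>Bounds and subadditivity of upper probabilities are available only on measurable sets,
  so the modal axioms rely on this. Each connective yields a generator, a Boolean combination of
  measurable sets, or a preimage under \<open>\<alpha>\<close>.\<close>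

lemma sem_measurable:
  assumes T: "upper_prob_polynomial T" and \<alpha>: "coalgebra T X \<alpha>"
    and "has_sort T \<phi> S" "consts_measurable \<phi>"
  shows "sem T X \<alpha> S \<phi> \<in> msets (obj X S)"
  using assms(3,4)
proof (induction rule: has_sort.induct)
  have X: "uncertainty_space X" using \<alpha> by (simp add: coalgebra_def)
  have space: "uncertainty_space (obj X S)" if "S \<in> Ing T" for S
    using obj_coded[OF X upper_prob_polynomial_Ing[OF T that]] by blast
  {
    case (bot S)
    then show ?case using uncertainty_spaceD(1)[OF space] by simp
  next
    case (imp \<phi> S \<psi>)
    then show ?case
      using uncertainty_spaceD(3,4)[OF space[OF has_sort_in_Ing[OF imp(1)]]] by simp
  next
    case (cst M A)
    then show ?case by (simp add: transport_def)
  next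
    case (pr1 S1 S2 \<phi>)
    let ?A = "obj X S1" and ?B = "obj X S2" and ?U = "sem T X \<alpha> S1 \<phi>"
    have "S2 \<in> Ing T" using Ing_components(1)[OF pr1(1)] by simp
    \<comment> \<open>The preimage under a projection is a rectangle with one full side, hence a
      generator.\<close>
    then have "?U \<times> points ?B \<in> msets (prod_space ?A ?B)"
      using pr1 uncertainty_spaceD(2)[OF space]
      by (auto simp: prod_space_def intro!: hull_inc)
    moreover have "{z \<in> points ?A \<times> points ?B. fst z \<in> ?U} = ?U \<times> points ?B"
      using sem_subset[OF T pr1(2), of X \<alpha>] by auto
    ultimately show ?case by (simp add: transport_def)
  next
    case (pr2 S1 S2 \<phi>)
    let ?A = "obj X S1" and ?B = "obj X S2" and ?U = "sem T X \<alpha> S2 \<phi>"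
    have "S1 \<in> Ing T" using Ing_components(1)[OF pr2(1)] by simp
    then have "points ?A \<times> ?U \<in> msets (prod_space ?A ?B)"
      using pr2 uncertainty_spaceD(2)[OF space]
      by (auto simp: prod_space_def intro!: hull_inc)
    moreover have "{z \<in> points ?A \<times> points ?B. snd z \<in> ?U} = points ?A \<times> ?U"
      using sem_subset[OF T pr2(2), of X \<alpha>] by auto
    ultimately show ?case by (simp add: transport_def)
  next
    case (in1 S1 S2 \<phi>)
    let ?A = "obj X S1" and ?B = "obj X S2" and ?U = "sem T X \<alpha> S1 \<phi>"
    have S: "S1 \<in> Ing T" "S2 \<in> Ing T" using Ing_components(2)[OF in1(1)] by simp_all
    have "Inl ` ?U \<in> msets (sum_space ?A ?B)" "Inr ` points ?B \<in> msets (sum_space ?A ?B)"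
      using in1 uncertainty_spaceD(2)[OF space[OF S(2)]]
      by (auto simp: sum_space_def intro!: hull_inc)
    from uncertainty_spaceD(4)[OF uncertainty_space_sum[OF space space] this] S
    have "sumV ` (Inl ` ?U \<union> Inr ` points ?B) \<in> msets (obj X (Sumf S1 S2))"
      by (simp add: transport_def)
    then show ?case by (simp add: sumV_def image_Un image_image del: obj.simps)
  next
    case (in2 S1 S2 \<phi>)
    let ?A = "obj X S1" and ?B = "obj X S2" and ?U = "sem T X \<alpha> S2 \<phi>"
    have S: "S1 \<in> Ing T" "S2 \<in> Ing T" using Ing_components(2)[OF in2(1)] by simp_all
    have "Inl ` points ?A \<in> msets (sum_space ?A ?B)" "Inr ` ?U \<in> msets (sum_space ?A ?B)"
      using in2 uncertainty_spaceD(2)[OF space[OF S(1)]]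
      by (auto simp: sum_space_def intro!: hull_inc)
    from uncertainty_spaceD(4)[OF uncertainty_space_sum[OF space space] this] S
    have "sumV ` (Inl ` points ?A \<union> Inr ` ?U) \<in> msets (obj X (Sumf S1 S2))"
      by (simp add: transport_def)
    then show ?case by (simp add: sumV_def image_Un image_image del: obj.simps)
  next
    case (next_step \<phi>)
    \<comment> \<open>This is the form in which measurability of \<open>\<alpha>\<close>
      applies.\<close>
    have "{x \<in> points X. \<alpha> x \<in> sem T X \<alpha> T \<phi>} = \<alpha> -` sem T X \<alpha> T \<phi> \<inter> points X"
      by auto
    then show ?case
      using next_step \<alpha> by (auto simp: coalgebra_def measurable_map_def transport_def)
  next
    case (modal S p q \<phi>)
    then have "beta (obj X S) p q (sem T X \<alpha> S \<phi>) \<in> msets (delta_star (obj X S))"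
      unfolding delta_star_def snd_conv by (intro hull_inc) auto
    then show ?case by (simp add: transport_def)
  }
qed


section \<open>Validity of the axioms\<close>

lemma sem_Imp_iff:
  assumes "x \<in> points (obj X S)"
  shows "x \<in> sem T X \<alpha> S (Imp \<phi> \<psi>) \<longleftrightarrow> (x \<in> sem T X \<alpha> S \<phi> \<longrightarrow> x \<in> sem T X \<alpha> S \<psi>)"
  using assms by auto

text \<open>A fixed point \<open>x\<close> induces an assignment, by membership, and
  \<open>sem\<close> treats \<open>Bot\<close> and \<open>Imp\<close> at \<open>x\<close> by their
  truth tables. This makes tautologies valid.\<close>

lemma truth_sem_iff:
  assumes "x \<in> points (obj X S)"
  shows "truth (\<lambda>\<psi>. x \<in> sem T X \<alpha> S \<psi>) \<phi> \<longleftrightarrow> x \<in> sem T X \<alpha> S \<phi>"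
  by (induction \<phi>) (simp_all only: truth.simps sem_Imp_iff[OF assms] sem.simps(1) empty_iff)

lemma Ax_has_sort:
  assumes "S \<in> Ing T" "\<phi> \<in> Ax T S"
  shows "has_sort T \<phi> S"
  using assms(2)
proof cases
  \<comment> \<open>The singleton clause of \<open>cst\<close> types \<open>{c}\<close> even when it
    is not measurable.\<close>
  case (const_in M c A)
  then show ?thesis using assms(1) by (auto intro!: has_sort.intros)
next
  case (const_notin M c A)
  then show ?thesis using assms(1) by (auto intro!: has_sort.intros)
qed (use assms(1) in \<open>auto intro!: has_sort.intros Ing_refl dest: Ing_components\<close>)

text \<open>Injectivity of \<open>upV\<close> on upper probabilities lets membership of the encoded
  measure be tested on \<open>g\<close> itself.\<close>

lemma sem_Mod_iff:
  assumes "uncertainty_space X" "upper_prob_polynomial S" "g \<in> upper_probs (obj X S)"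
  shows "upV (obj X S) g \<in> sem T X \<alpha> (Deltaf S) (Mod p q \<phi>) \<longleftrightarrow>
    p \<le> g (sem T X \<alpha> S \<phi>) \<and> q \<le> 1 - g (points (obj X S) - sem T X \<alpha> S \<phi>)"
proof -
  have "inj_on (upV (obj X S)) (upper_probs (obj X S))"
    using inj_on_upV_obj[OF assms(1,2)] by (simp add: delta_star_def)
  then have "upV (obj X S) g \<in> upV (obj X S) ` beta (obj X S) p q U \<longleftrightarrow> g \<in> beta (obj X S) p q U"
    for U
    by (rule inj_on_image_mem_iff) (use assms(3) in \<open>auto simp: beta_def\<close>)
  then show ?thesis using assms(3) by (simp add: beta_def)
qed

theorem theorem3p12:
  fixes T S :: "'m pfunctor" and X :: "'x uspace" and \<alpha> :: "'x \<Rightarrow> ('x, 'm) val"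
    and \<phi> :: "'m form"
  assumes "upper_prob_polynomial T"
    and "S \<in> Ing T"
    and "coalgebra T X \<alpha>"
    and "\<phi> \<in> Ax T S"
  shows "sem T X \<alpha> S \<phi> = points (obj X S)"
proof
  show "sem T X \<alpha> S \<phi> \<subseteq> points (obj X S)"
    by (rule sem_subset[OF assms(1) Ax_has_sort[OF assms(2,4)]])
  have X: "uncertainty_space X" using assms(3) by (simp add: coalgebra_def)
  have S: "upper_prob_polynomial S" by (rule upper_prob_polynomial_Ing[OF assms(1,2)])
  have upV_in_points: "upV (obj X S') g \<in> points (obj X (Deltaf S'))"
    if "g \<in> upper_probs (obj X S')" for S' g
    using that by (simp add: points_obj del: obj.simps)
  note Imp_iff = sem_Imp_iff[OF upV_in_points]
  have Mod_iff: "upV (obj X S') g \<in> sem T X \<alpha> (Deltaf S') (Mod p q \<psi>) \<longleftrightarrow>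
      p \<le> g (sem T X \<alpha> S' \<psi>) \<and> q \<le> 1 - g (points (obj X S') - sem T X \<alpha> S' \<psi>)"
    if "S = Deltaf S'" "g \<in> upper_probs (obj X S')" for S' g p q \<psi>
    using sem_Mod_iff[OF X _ that(2)] S that(1) by simp
  have space: "uncertainty_space (obj X S')" if "S = Deltaf S'" for S'
    using obj_coded[OF X, of S'] S that by simp
  note measurable = sem_measurable[OF assms(1,3)]
  show "points (obj X S) \<subseteq> sem T X \<alpha> S \<phi>"
    using assms(4)
  proof cases
    case taut
    then show ?thesis using truth_sem_iff by (fastforce simp: tautology_def)
  next
    case (next_neg \<psi>)
    \<comment> \<open>Negation is a complement relative to \<open>points (obj X T)\<close>, so
      \<open>\<alpha> x\<close> must lie there.\<close>
    have "\<alpha> x \<in> points (obj X T)" if "x \<in> points X" for x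
      using assms(3) that by (auto simp: coalgebra_def measurable_map_def)
    then show ?thesis using next_neg by (auto simp: points_obj simp del: obj.simps)
  next
    case (U_le_lt S' \<psi> p q)
    let ?U = "sem T X \<alpha> S' \<psi>"
    have "?U \<subseteq> points (obj X S')" by (rule sem_subset[OF assms(1) U_le_lt(3)])
    \<comment> \<open>\<open>U_le\<close> refers to the negation, so its lower bound involves a
      double complement; undoing it turns the condition into \<open>g ?U \<le> p\<close>.\<close>
    then have "points (obj X S') - (points (obj X S') - ?U) = ?U" by blast
    then have "upV (obj X S') g \<in> sem T X \<alpha> S \<phi>" if "g \<in> upper_probs (obj X S')" for g
      using that U_le_lt(7) unfolding U_le_lt(1,2)
      by (simp add: Imp_iff Mod_iff U_le_lt(2) del: sem.simps(2,9)) (simp del: sem.simps(9))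
    then show ?thesis using U_le_lt(2) by (auto simp: points_obj simp del: obj.simps)
  next
    case (U_lt_le S' \<psi> p)
    let ?U = "sem T X \<alpha> S' \<psi>"
    have "?U \<subseteq> points (obj X S')" by (rule sem_subset[OF assms(1) U_lt_le(3)])
    then have "points (obj X S') - (points (obj X S') - ?U) = ?U" by blast
    \<comment> \<open>The value of \<open>g\<close> on the complement then lies in [0,1], which
      settles the conditions with threshold 0.\<close>
    moreover have "points (obj X S') - ?U \<in> msets (obj X S')"
      using uncertainty_spaceD(3)[OF space measurable] U_lt_le by blast
    ultimately have "upV (obj X S') g \<in> sem T X \<alpha> S \<phi>" if "g \<in> upper_probs (obj X S')" for g
      using that upper_probs_bounds[OF that] unfolding U_lt_le(1,2)
      by (simp add: Imp_iff Mod_iff U_lt_le(2) del: sem.simps(2,9)) (simp del: sem.simps(9))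
    then show ?thesis using U_lt_le(2) by (auto simp: points_obj simp del: obj.simps)
  next
    case (L_imp S' \<psi> \<theta> p)
    let ?A = "obj X S'" and ?U = "sem T X \<alpha> S' \<psi>" and ?V = "sem T X \<alpha> S' \<theta>"
    have UV: "?U \<in> msets ?A" "?V \<in> msets ?A" using measurable L_imp by blast+
    \<comment> \<open>Hence \<open>L_ge 1\<close> of the implication says
      \<open>g (?U - ?V) \<le> 0\<close>, and subadditivity gives
      \<open>g ?U \<le> g ?V\<close>.\<close>
    have compl: "points ?A - sem T X \<alpha> S' (Imp \<psi> \<theta>) = ?U - ?V"
      using sem_subset[OF assms(1) L_imp(3), of X \<alpha>] by auto
    have "upV ?A g \<in> sem T X \<alpha> S \<phi>" if g: "g \<in> upper_probs ?A" for g
    proof -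
      have "g ?U \<le> g (?U - ?V) + g ?V"
        by (rule upper_probs_le_Diff[OF space[OF L_imp(2)] g UV])
      moreover have "g (points ?A - ?V) \<le> 1"
        using upper_probs_bounds(2)[OF g] uncertainty_spaceD(3)[OF space[OF L_imp(2)] UV(2)] .
      ultimately show ?thesis
        using g unfolding L_imp(1,2)
        by (simp add: Imp_iff Mod_iff L_imp(2) compl del: sem.simps(2,9))
    qed
    then show ?thesis using L_imp(2) by (auto simp: points_obj simp del: obj.simps)
  next
    case (mod_split S' \<psi> p q)
    let ?A = "obj X S'" and ?U = "sem T X \<alpha> S' \<psi>"
    have U: "?U \<in> msets ?A" using measurable mod_split by blast
    have "upV ?A g \<in> sem T X \<alpha> S \<phi>" if g: "g \<in> upper_probs ?A" for g
    proof -
      \<comment> \<open>These two bounds discharge the threshold-0 halves of \<open>U_ge\<close> and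
        \<open>L_ge\<close>, leaving exactly the two conditions of \<open>Mod p q\<close>.\<close>
      have "0 \<le> g ?U" by (rule upper_probs_bounds(1)[OF g U])
      moreover have "g (points ?A - ?U) \<le> 1"
        using upper_probs_bounds(2)[OF g] uncertainty_spaceD(3)[OF space[OF mod_split(2)] U] .
      ultimately show ?thesis
        using g unfolding mod_split(1,2)
        by (simp add: Imp_iff Mod_iff mod_split(2) del: sem.simps(2,9))
    qed
    then show ?thesis using mod_split(2) by (auto simp: points_obj simp del: obj.simps)
  \<comment> \<open>The remaining axioms, on constants, projections, injections and
    \<open>Next Bot\<close>, follow from the shape of the points of each sort.\<close>
  qed (auto simp: points_obj pairV_def simp del: obj.simps)
qed

end
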